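(* There exists an absolute constant $C$ such that the following holds for every odd prime $p$, positive integer $n$, and vector $\boldsymbol{a}=(a_1,\dots,a_n)\in\mathbb{F}_p^n\setminus\{\boldsymbol{0}\}$. Suppose that an integer $k\ge0$ and a positive real $M$ satisfy $30M\le|\mathrm{supp}(\boldsymbol{a})|$ and $80kM\le n$. Then $$\rho_{\mathbb{F}_p}(\boldsymbol{a})\le\frac1p+\frac{C R_k(\boldsymbol{a})}{2^{2k}n^{2k}\cdot M^{1/2}}+e^{-M}.$$
   Context: For $\boldsymbol{a}\in\mathbb{F}_p^n$: $\mathrm{supp}(\boldsymbol{a})=\{i: a_i\ne0\}$; $\rho_{\mathbb{F}_p}(\boldsymbol{a})=\sup_{x\in\mathbb{F}_p}\Pr(\epsilon_1a_1+\dots+\epsilon_na_n=x)$, where $\epsilon_1,\dots,\epsilon_n$ are i.i.d. Rademacher random variables ($\pm1$ with probability $1/2$ each) and arithmetic is in $\mathbb{F}_p$; $R_k(\boldsymbol{a})$ is the number of solutions to $\pm a_{i_1}\pm a_{i_2}\pm\dots\pm a_{i_{2k}}=0$ in $\mathbb{F}_p$, with repetitions allowed, i.e. the number of pairs consisting of a sequence $(i_1,\dots,i_{2k})\in\{1,\dots,n\}^{2k}$ and a sign pattern $(\eta_1,\dots,\eta_{2k})\in\{\pm1\}^{2k}$ such that $\sum_j\eta_ja_{i_j}=0$ in $\mathbb{F}_p$ (for $k=0$ the empty sum is $0$, so $R_0(\boldsymbol{a})=1$). *)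

theory Defs
  imports "HOL-Number_Theory.Residues" "HOL-Probability.Probability"
begin

text \<open>
  Since \<open>p\<close> varies inside the statement, the field of order \<open>p\<close> is the library's
  \<^const>\<open>residue_ring\<close>, with carrier \<open>{0..p - 1}\<close>; an identity between sums in it is written
  as a congruence of integers modulo \<open>p\<close>. Vectors are indexed by \<open>{1..n}\<close>.
\<close>

definition Fp_vectors :: "nat \<Rightarrow> nat \<Rightarrow> (nat \<Rightarrow> int) set" where
  "Fp_vectors p n = ({1..n} \<rightarrow>\<^sub>E carrier (residue_ring (int p)))"

definition zero_vector :: "nat \<Rightarrow> nat \<Rightarrow> int" where
  "zero_vector n = (\<lambda>i\<in>{1..n}. 0)"

definition supp :: "nat \<Rightarrow> (nat \<Rightarrow> int) \<Rightarrow> nat set" where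
  "supp n a = {i \<in> {1..n}. a i \<noteq> 0}"

definition rademacher_pmf :: "int pmf" where
  "rademacher_pmf = pmf_of_set {-1, 1}"

text \<open>\<open>Pi_pmf\<close> is the product distribution: the coordinates are independent
  (and equal to the dummy value \<open>0\<close> outside \<open>{1..n}\<close>).\<close>

definition rho :: "nat \<Rightarrow> nat \<Rightarrow> (nat \<Rightarrow> int) \<Rightarrow> real" where
  "rho p n a = (SUP x \<in> carrier (residue_ring (int p)).
     measure_pmf.prob (Pi_pmf {1..n} 0 (\<lambda>_. rademacher_pmf))
       {\<epsilon>. [(\<Sum>i\<in>{1..n}. \<epsilon> i * a i) = x] (mod int p)})"

definition R :: "nat \<Rightarrow> nat \<Rightarrow> nat \<Rightarrow> (nat \<Rightarrow> int) \<Rightarrow> nat" where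
  "R p n k a = card {(\<iota>, \<eta>).
     \<iota> \<in> {1..2 * k} \<rightarrow>\<^sub>E {1..n} \<and> \<eta> \<in> {1..2 * k} \<rightarrow>\<^sub>E {-1, 1 :: int} \<and>
     [(\<Sum>j\<in>{1..2 * k}. \<eta> j * a (\<iota> j)) = 0] (mod int p)}"

end

theory Submission
  imports Defs
begin

text \<open>
  The proof follows Halasz. By Fourier inversion modulo \<open>p\<close>, every value of \<open>\<Sum>i. \<epsilon>\<^sub>i a\<^sub>i\<close> has probability at
  most \<open>1/p \<Sum>x. \<Prod>i. \<bar>cos (2\<pi> x a\<^sub>i / p)\<bar>\<close>, and \<open>\<bar>cos \<theta>\<bar> \<le> exp (- sin\<^sup>2 \<theta> / 2)\<close> bounds this by
  \<open>1/p \<Sum>x. exp (- g(x)\<^sup>2 / 2)\<close>, where \<open>g(x)\<close> is the Euclidean norm of the vector of all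
  \<open>sin (2\<pi> x a\<^sub>i / p)\<close> (\<open>rho_le_gaussian_sum\<close>). Everything then depends on how many residues \<open>x\<close> have small \<open>g(x)\<close>.

  Because \<open>g\<close> is subadditive, the balls \<open>B\<^sub>r = {x. g(x) \<le> r}\<close> satisfy \<open>B\<^sub>r + B\<^sub>s \<subseteq> B\<close> with radius \<open>r + s\<close> on the right,
  so the Cauchy-Davenport inequality forces \<open>B\<^sub>s\<close> without its centre to be smaller than \<open>B\<^sub>r\<close> by a factor of
  order \<open>s / r\<close>, unless \<open>B\<^sub>r\<close> is everything (\<open>card_small_sin_ball_le\<close>). Take \<open>r = sqrt (2M)\<close>. The mean of
  \<open>g(x)\<^sup>2\<close> over all residues is half the size of the support, which exceeds \<open>r\<^sup>2\<close> by the assumption on the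
  support; hence \<open>B\<^sub>r\<close> is proper (\<open>sin_ball_proper\<close>). Splitting the Gaussian sum into the centre, the rest
  of \<open>B\<^sub>r\<close>, and its complement yields \<open>1/p\<close>, a multiple of \<open>card B\<^sub>r / (p sqrt M)\<close>, and
  \<open>exp (- M)\<close> (\<open>gaussian_sum_le_card_sin_ball\<close>).

  Finally \<open>R\<close> controls \<open>B\<^sub>r\<close>: the \<open>2k\<close>-th powers of \<open>\<Sum>i. 2 cos (4\<pi> x a\<^sub>i / p) = 2 (n - 2 g(x)\<^sup>2)\<close> add up to \<open>p R\<close>
  over all residues, and the assumption relating \<open>k M\<close> to \<open>n\<close> makes each \<open>x \<in> B\<^sub>r\<close> contribute at least a constant
  multiple of \<open>(2n)\<^sup>2\<^sup>k\<close> (\<open>card_sin_ball_le_R\<close>).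
\<close>

section \<open>Additive characters modulo \<open>p\<close>\<close>

definition phase :: "nat \<Rightarrow> int \<Rightarrow> complex" where
  "phase p y = cis (2 * pi * real_of_int y / real p)"

lemma phase_0 [simp]: "phase p 0 = 1"
  by (simp add: phase_def)

lemma phase_add: "phase p (x + y) = phase p x * phase p y"
  by (simp add: phase_def cis_mult add_divide_distrib ring_distribs)

lemma phase_sum: "phase p (\<Sum>i\<in>A. f i) = (\<Prod>i\<in>A. phase p (f i))"
  by (induction A rule: infinite_finite_induct) (simp_all add: phase_add)

lemma norm_phase [simp]: "norm (phase p y) = 1"
  by (simp add: phase_def)

lemma sum_signs_phase:
  "(\<Sum>e\<in>{-1, 1}. phase p (e * y)) = complex_of_real (2 * cos (2 * pi * real_of_int y / real p))"
  by (simp add: phase_def complex_eq_iff)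

lemma phase_eq_1_iff:
  assumes "p > 0"
  shows "phase p y = 1 \<longleftrightarrow> int p dvd y"
proof
  assume "phase p y = 1"
  then have "cos (2 * pi * real_of_int y / real p) = 1"
    by (simp add: phase_def complex_eq_iff)
  then obtain m :: int where "2 * pi * real_of_int y / real p = of_int m * 2 * pi"
    by (auto simp: cos_one_2pi_int)
  then have "real_of_int y = of_int m * real p"
    using assms by (simp add: field_simps)
  then have "real_of_int y = real_of_int (m * int p)" by simp
  then have "y = m * int p" by (simp only: of_int_eq_iff)
  then show "int p dvd y" by simp
next
  assume "int p dvd y"
  then obtain m where "y = int p * m" by (auto elim: dvdE)
  then have "2 * pi * real_of_int y / real p = 2 * pi * real_of_int m"
    using assms by simp
  then show "phase p y = 1" by (simp only: phase_def cis_multiple_2pi Ints_of_int)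
qed

text \<open>
  The sum is geometric with ratio a \<open>p\<close>-th root of unity.
\<close>
lemma sum_phase_residues:
  assumes "p > 0"
  shows "(\<Sum>t\<in>{0..<int p}. phase p (t * y)) = (if int p dvd y then of_nat p else 0)"
proof -
  have power: "phase p (int t * y) = phase p y ^ t" for t
  proof (induction t)
    case (Suc t)
    have "int (Suc t) * y = y + int t * y" by (simp add: algebra_simps)
    then show ?case using Suc.IH by (simp only: phase_add power_Suc)
  qed simp
  have "(\<Sum>t\<in>{0..<int p}. phase p (t * y)) = (\<Sum>t\<in>int ` {0..<p}. phase p (t * y))"
    by (simp add: image_int_atLeastLessThan)
  also have "\<dots> = (\<Sum>t<p. phase p y ^ t)"
    by (subst sum.reindex) (simp_all add: power atLeast0LessThan)
  finally have geometric: "(\<Sum>t\<in>{0..<int p}. phase p (t * y)) = (\<Sum>t<p. phase p y ^ t)" .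
  show ?thesis
  proof (cases "int p dvd y")
    case True
    then have "phase p y = 1" using assms by (simp add: phase_eq_1_iff)
    then show ?thesis using True geometric by simp
  next
    case False
    have "phase p y ^ p = 1"
      using assms by (simp flip: power add: phase_eq_1_iff)
    then have "(\<Sum>t<p. phase p y ^ t) = 0"
      using False assms by (simp add: geometric_sum phase_eq_1_iff)
    then show ?thesis using False geometric by simp
  qed
qed

text \<open>
  Orthogonality turns the counting of solutions of a congruence into a sum over frequencies. It serves
  twice: for the sign vectors hitting a given value, and for the solutions counted by \<open>R\<close>.
\<close>
lemma card_zeros_mod:
  assumes "p > 0" "finite \<Omega>"
  shows "of_nat p * of_nat (card {\<omega>\<in>\<Omega>. int p dvd s \<omega>})
         = (\<Sum>t\<in>{0..<int p}. \<Sum>\<omega>\<in>\<Omega>. phase p (t * s \<omega>))"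
proof -
  have "(\<Sum>t\<in>{0..<int p}. \<Sum>\<omega>\<in>\<Omega>. phase p (t * s \<omega>))
        = (\<Sum>\<omega>\<in>\<Omega>. if int p dvd s \<omega> then of_nat p else 0)"
    using assms by (subst sum.swap) (simp add: sum_phase_residues)
  also have "\<dots> = of_nat p * of_nat (card {\<omega>\<in>\<Omega>. int p dvd s \<omega>})"
    using assms by (simp add: sum.If_cases Int_def mult.commute)
  finally show ?thesis by simp
qed

lemma sum_PiE_dflt_prod:
  fixes f :: "'a \<Rightarrow> 'b \<Rightarrow> 'c :: comm_semiring_1"
  assumes "finite A" "\<And>x. x \<in> A \<Longrightarrow> finite (B x)"
  shows "(\<Sum>g\<in>PiE_dflt A d B. \<Prod>x\<in>A. f x (g x)) = (\<Prod>x\<in>A. \<Sum>y\<in>B x. f x y)"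
proof -
  have inj: "inj_on (\<lambda>h x. if x \<in> A then h x else d) (PiE A B)"
  proof (rule inj_onI)
    fix g h assume gh: "g \<in> PiE A B" "h \<in> PiE A B"
      and eq: "(\<lambda>x. if x \<in> A then g x else d) = (\<lambda>x. if x \<in> A then h x else d)"
    show "g = h"
    proof (rule PiE_ext[OF gh])
      fix x assume "x \<in> A" then show "g x = h x" using fun_cong[OF eq, of x] by simp
    qed
  qed
  show ?thesis
    unfolding dflt_image_PiE[symmetric]
    by (subst sum.reindex[OF inj]) (simp add: prod_sum_PiE assms)
qed

text \<open>
  For a fixed frequency the sum over all sign vectors factorises over the coordinates, and each
  coordinate contributes \<open>e\<^sup>i\<^sup>\<theta> + e\<^sup>-\<^sup>i\<^sup>\<theta> = 2 cos \<theta>\<close>. The target value \<open>x\<close> only contributes a factor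
  of modulus one, so it disappears from the bound.
\<close>
lemma card_sign_vectors_hitting:
  fixes a :: "nat \<Rightarrow> int" and n :: nat
  assumes "p > 0"
  defines "S \<equiv> (\<lambda>\<epsilon>. \<Sum>i\<in>{1..n}. \<epsilon> i * a i)"
  shows "real p * real (card {\<epsilon>\<in>PiE_dflt {1..n} 0 (\<lambda>_. {-1, 1}). [S \<epsilon> = x] (mod int p)})
         \<le> 2 ^ n * (\<Sum>t\<in>{0..<int p}. \<Prod>i\<in>{1..n}. \<bar>cos (2 * pi * real_of_int (t * a i) / real p)\<bar>)"
proof -
  let ?\<Omega> = "PiE_dflt {1..n} (0::int) (\<lambda>_. {-1, 1})"
  have fin: "finite ?\<Omega>" by auto
  have inner: "(\<Sum>\<epsilon>\<in>?\<Omega>. phase p (t * (S \<epsilon> - x)))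
      = phase p (- (t * x)) *
        complex_of_real (2 ^ n * (\<Prod>i\<in>{1..n}. cos (2 * pi * real_of_int (t * a i) / real p)))" for t
  proof -
    have "t * (S \<epsilon> - x) = - (t * x) + (\<Sum>i\<in>{1..n}. \<epsilon> i * (t * a i))" for \<epsilon>
      by (simp add: S_def right_diff_distrib sum_distrib_left mult.left_commute)
    then have "(\<Sum>\<epsilon>\<in>?\<Omega>. phase p (t * (S \<epsilon> - x)))
        = phase p (- (t * x)) * (\<Sum>\<epsilon>\<in>?\<Omega>. \<Prod>i\<in>{1..n}. phase p (\<epsilon> i * (t * a i)))"
      by (simp only: phase_add phase_sum sum_distrib_left)
    also have "(\<Sum>\<epsilon>\<in>?\<Omega>. \<Prod>i\<in>{1..n}. phase p (\<epsilon> i * (t * a i)))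
        = (\<Prod>i\<in>{1..n}. \<Sum>e\<in>{-1, 1}. phase p (e * (t * a i)))"
      by (rule sum_PiE_dflt_prod) auto
    also have "\<dots> = (\<Prod>i\<in>{1..n}. complex_of_real (2 * cos (2 * pi * real_of_int (t * a i) / real p)))"
      by (simp only: sum_signs_phase)
    also have "\<dots> = complex_of_real (\<Prod>i\<in>{1..n}. 2 * cos (2 * pi * real_of_int (t * a i) / real p))"
      by (rule of_real_prod[symmetric])
    also have "(\<Prod>i\<in>{1..n}. 2 * cos (2 * pi * real_of_int (t * a i) / real p))
        = 2 ^ n * (\<Prod>i\<in>{1..n}. cos (2 * pi * real_of_int (t * a i) / real p))"
      by (simp add: prod.distrib)
    finally show ?thesis .
  qed
  have set_eq: "{\<epsilon>\<in>?\<Omega>. [S \<epsilon> = x] (mod int p)} = {\<epsilon>\<in>?\<Omega>. int p dvd S \<epsilon> - x}"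
    by (simp add: cong_iff_dvd_diff)
  have "real p * real (card {\<epsilon>\<in>?\<Omega>. [S \<epsilon> = x] (mod int p)})
      = norm (of_nat p * of_nat (card {\<epsilon>\<in>?\<Omega>. int p dvd S \<epsilon> - x}) :: complex)"
    unfolding set_eq norm_mult by simp
  also have "\<dots> = norm (\<Sum>t\<in>{0..<int p}. \<Sum>\<epsilon>\<in>?\<Omega>. phase p (t * (S \<epsilon> - x)))"
    by (subst card_zeros_mod[OF assms(1) fin]) simp
  also have "\<dots> \<le> (\<Sum>t\<in>{0..<int p}. norm (\<Sum>\<epsilon>\<in>?\<Omega>. phase p (t * (S \<epsilon> - x))))"
    by (rule norm_sum)
  also have "\<dots> = (\<Sum>t\<in>{0..<int p}. 2 ^ n * (\<Prod>i\<in>{1..n}. \<bar>cos (2 * pi * real_of_int (t * a i) / real p)\<bar>))"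
    unfolding inner norm_mult norm_of_real abs_mult abs_prod by simp
  finally show ?thesis by (simp only: sum_distrib_left)
qed

lemma rho_le_cosine_products:
  assumes "p > 0"
  shows "rho p n a
     \<le> (\<Sum>t\<in>{0..<int p}. \<Prod>i\<in>{1..n}. \<bar>cos (2 * pi * real_of_int (t * a i) / real p)\<bar>) / real p"
  unfolding rho_def
proof (rule cSUP_least)
  show "carrier (residue_ring (int p)) \<noteq> {}"
    using assms by (simp add: residue_ring_def)
next
  fix x
  let ?\<Omega> = "PiE_dflt {1..n} (0::int) (\<lambda>_. {-1, 1})"
  let ?E = "{\<epsilon>. [(\<Sum>i\<in>{1..n}. \<epsilon> i * a i) = x] (mod int p)}"
  have fin: "finite ?\<Omega>" by auto
  have ne: "?\<Omega> \<noteq> {}" by simp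
  have "measure_pmf.prob (Pi_pmf {1..n} 0 (\<lambda>_. rademacher_pmf)) ?E = real (card (?\<Omega> \<inter> ?E)) / real (card ?\<Omega>)"
  proof -
    have "Pi_pmf {1..n} 0 (\<lambda>_. rademacher_pmf) = pmf_of_set ?\<Omega>"
      unfolding rademacher_pmf_def by (rule Pi_pmf_of_set) auto
    then show ?thesis by (simp only: measure_pmf_of_set[OF ne fin])
  qed
  also have "card ?\<Omega> = 2 ^ n"
    by (subst card_PiE_dflt) (simp_all add: numeral_2_eq_2)
  also have "?\<Omega> \<inter> ?E = {\<epsilon>\<in>?\<Omega>. [(\<Sum>i\<in>{1..n}. \<epsilon> i * a i) = x] (mod int p)}"
    by auto
  finally have prob: "measure_pmf.prob (Pi_pmf {1..n} 0 (\<lambda>_. rademacher_pmf)) ?E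
      = real (card {\<epsilon>\<in>?\<Omega>. [(\<Sum>i\<in>{1..n}. \<epsilon> i * a i) = x] (mod int p)}) / 2 ^ n"
    by simp
  have divide: "c / 2 ^ n \<le> b / real p" if "real p * c \<le> 2 ^ n * b" for b c :: real
    using that assms by (simp add: field_simps)
  show "measure_pmf.prob (Pi_pmf {1..n} 0 (\<lambda>_. rademacher_pmf)) ?E
     \<le> (\<Sum>t\<in>{0..<int p}. \<Prod>i\<in>{1..n}. \<bar>cos (2 * pi * real_of_int (t * a i) / real p)\<bar>) / real p"
    unfolding prob by (rule divide[OF card_sign_vectors_hitting[OF assms]])
qed

text \<open>
  Expanding the \<open>2k\<close>-th power gives one character for each choice of \<open>2k\<close> signed entries of \<open>a\<close>.
  The frequency is doubled so that \<open>cos (2\<theta>) = 1 - 2 sin\<^sup>2 \<theta>\<close> relates these cosines to the sines at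
  the original frequency; as \<open>p\<close> is odd, \<open>p\<close> divides twice a signed sum exactly if it divides the sum.
\<close>
lemma sum_cosine_moments_eq_R:
  assumes "p > 0" "odd p"
  shows "(\<Sum>t\<in>{0..<int p}. (\<Sum>i\<in>{1..n}. 2 * cos (2 * pi * real_of_int (2 * t * a i) / real p)) ^ (2 * k))
         = real p * real (R p n k a)"
proof -
  let ?I = "{1..2 * k} \<rightarrow>\<^sub>E {1..n}" and ?H = "{1..2 * k} \<rightarrow>\<^sub>E {-1, 1 :: int}"
  let ?S = "\<lambda>(\<iota>, \<eta>). \<Sum>j\<in>{1..2 * k}. \<eta> j * a (\<iota> j)"
  have fin: "finite (?I \<times> ?H)" by (intro finite_cartesian_product finite_PiE) auto
  have moment: "complex_of_real ((\<Sum>i\<in>{1..n}. 2 * cos (2 * pi * real_of_int (2 * t * a i) / real p)) ^ (2 * k))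
      = (\<Sum>\<omega>\<in>?I \<times> ?H. phase p (t * (2 * ?S \<omega>)))" for t
  proof -
    have "complex_of_real (\<Sum>i\<in>{1..n}. 2 * cos (2 * pi * real_of_int (2 * t * a i) / real p))
        = (\<Sum>i\<in>{1..n}. \<Sum>e\<in>{-1, 1}. phase p (e * (2 * t * a i)))"
      unfolding of_real_sum
      by (simp only: sum_signs_phase)
    then have "complex_of_real ((\<Sum>i\<in>{1..n}. 2 * cos (2 * pi * real_of_int (2 * t * a i) / real p)) ^ (2 * k))
        = (\<Prod>j\<in>{1..2 * k}. \<Sum>i\<in>{1..n}. \<Sum>e\<in>{-1, 1}. phase p (e * (2 * t * a i)))"
      by (simp only: of_real_power prod_constant card_atLeastAtMost) simp
    also have "\<dots> = (\<Sum>\<iota>\<in>?I. \<Prod>j\<in>{1..2 * k}. \<Sum>e\<in>{-1, 1}. phase p (e * (2 * t * a (\<iota> j))))"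
      by (rule prod_sum_PiE) auto
    also have "\<dots> = (\<Sum>\<iota>\<in>?I. \<Sum>\<eta>\<in>?H. \<Prod>j\<in>{1..2 * k}. phase p (\<eta> j * (2 * t * a (\<iota> j))))"
      by (intro sum.cong refl prod_sum_PiE) auto
    also have "\<dots> = (\<Sum>\<omega>\<in>?I \<times> ?H. phase p (t * (2 * ?S \<omega>)))"
      unfolding sum.cartesian_product
      by (intro sum.cong refl)
         (auto simp flip: phase_sum simp: sum_distrib_left mult_ac)
    finally show ?thesis .
  qed
  have "{(\<iota>, \<eta>). \<iota> \<in> ?I \<and> \<eta> \<in> ?H \<and> [(\<Sum>j\<in>{1..2 * k}. \<eta> j * a (\<iota> j)) = 0] (mod int p)}
      = {\<omega>\<in>?I \<times> ?H. int p dvd 2 * ?S \<omega>}"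
  proof -
    have "coprime (int p) 2" using assms(2) by simp
    then have "int p dvd 2 * y \<longleftrightarrow> [y = 0] (mod int p)" for y
      by (simp add: coprime_dvd_mult_right_iff cong_0_iff)
    then show ?thesis by auto
  qed
  then have "complex_of_real (real p * real (R p n k a)) = of_nat p * of_nat (card {\<omega>\<in>?I \<times> ?H. int p dvd 2 * ?S \<omega>})"
    by (simp add: R_def)
  also have "\<dots> = (\<Sum>t\<in>{0..<int p}. \<Sum>\<omega>\<in>?I \<times> ?H. phase p (t * (2 * ?S \<omega>)))"
    by (rule card_zeros_mod[OF assms(1) fin])
  also have "\<dots> = complex_of_real (\<Sum>t\<in>{0..<int p}. (\<Sum>i\<in>{1..n}. 2 * cos (2 * pi * real_of_int (2 * t * a i) / real p)) ^ (2 * k))"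
    by (simp only: moment[symmetric] of_real_sum)
  finally show ?thesis by (simp only: of_real_eq_iff)
qed

section \<open>The Cauchy-Davenport inequality\<close>

definition sumset_mod :: "nat \<Rightarrow> int set \<Rightarrow> int set \<Rightarrow> int set" where
  "sumset_mod p A B = (\<lambda>(x, y). (x + y) mod int p) ` (A \<times> B)"

lemma sumset_modI: "x \<in> A \<Longrightarrow> y \<in> B \<Longrightarrow> (x + y) mod int p \<in> sumset_mod p A B"
  unfolding sumset_mod_def by (rule image_eqI[of _ _ "(x, y)"]) auto

lemma sumset_mod_subset: "p > 0 \<Longrightarrow> sumset_mod p A B \<subseteq> {0..<int p}"
  by (auto simp: sumset_mod_def)

lemma finite_sumset_mod: "p > 0 \<Longrightarrow> finite (sumset_mod p A B)"
  using sumset_mod_subset by (rule finite_subset) auto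

lemma inj_on_translate_mod: "inj_on (\<lambda>x. (x + d) mod int p) {0..<int p}"
proof (rule inj_onI)
  fix x y assume "x \<in> {0..<int p}" "y \<in> {0..<int p}" and "(x + d) mod int p = (y + d) mod int p"
  then have "[x + d = y + d] (mod int p)" by (simp only: unique_euclidean_semiring_class.cong_def)
  then have "[x = y] (mod int p)" by (simp only: cong_add_rcancel)
  then show "x = y" using \<open>x \<in> _\<close> \<open>y \<in> _\<close> by (simp add: unique_euclidean_semiring_class.cong_def)
qed

text \<open>
  A nonzero residue \<open>d\<close> generates the additive group, since it is invertible modulo the prime \<open>p\<close>.
\<close>
lemma translation_invariant_imp_full:
  assumes "prime p" "A \<subseteq> {0..<int p}" "A \<noteq> {}" "\<not> int p dvd d"
    and stable: "\<And>x. x \<in> A \<Longrightarrow> (x + d) mod int p \<in> A"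
  shows "A = {0..<int p}"
proof (rule antisym[OF assms(2)], rule subsetI)
  fix y assume y: "y \<in> {0..<int p}"
  obtain x where x: "x \<in> A" using assms(3) by blast
  have orbit: "(x + int m * d) mod int p \<in> A" for m
  proof (induction m)
    case 0
    then show ?case using x assms(2) by auto
  next
    case (Suc m)
    have "((x + int m * d) mod int p + d) mod int p = (x + int (Suc m) * d) mod int p"
      by (simp add: mod_simps algebra_simps)
    then show ?case using stable[OF Suc.IH] by simp
  qed
  have p: "p > 0" using assms(1) by (simp add: prime_gt_0_nat)
  have "coprime d (int p)"
    using assms(1,4) prime_imp_coprime[of "int p" d] by (simp add: coprime_commute)
  then obtain e where e: "[d * e = 1] (mod int p)" using coprime_iff_invertible_int by blast
  define m where "m = nat (((y - x) * e) mod int p)"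
  have "[int m * d = (y - x) * e * d] (mod int p)"
    using p by (intro cong_mult) (auto simp: m_def unique_euclidean_semiring_class.cong_def)
  also have "(y - x) * e * d = (y - x) * (d * e)" by simp
  also have "[\<dots> = (y - x) * 1] (mod int p)" using e by (intro cong_mult) auto
  finally have "[x + int m * d = x + (y - x) * 1] (mod int p)" by (intro cong_add) auto
  then have "(x + int m * d) mod int p = y" using y by (simp add: unique_euclidean_semiring_class.cong_def)
  then show "y \<in> A" using orbit[of m] by simp
qed

text \<open>
  Induction on the size of \<open>B\<close> by Dyson's transform. For a shift \<open>e = x - b\<close> with \<open>x \<in> A\<close> and \<open>b \<in> B\<close>, the pair
  \<open>A \<union> (B + e)\<close>, \<open>B \<inter> (A - e)\<close> has the same total size as \<open>A\<close>, \<open>B\<close>, its sumset lies in that of \<open>A\<close> and \<open>B\<close>,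
  and its second member is nonempty, as it contains \<open>b\<close>. If some shift makes the second member smaller
  than \<open>B\<close>, the induction hypothesis applies. Otherwise \<open>B + e \<subseteq> A\<close> for every such \<open>e\<close>, so \<open>A\<close> is invariant under all
  differences of elements of \<open>B\<close>; hence \<open>B\<close> is a singleton or \<open>A\<close> is everything.
\<close>
theorem Cauchy_Davenport:
  assumes "prime p" "A \<subseteq> {0..<int p}" "B \<subseteq> {0..<int p}" "A \<noteq> {}" "B \<noteq> {}"
  shows "min p (card A + card B - 1) \<le> card (sumset_mod p A B)"
  using assms(2-5)
proof (induction "card B" arbitrary: A B rule: less_induct)
  case less
  have p: "p > 0" using assms(1) by (simp add: prime_gt_0_nat)
  have finA: "finite A" and finB: "finite B"
    using less.prems finite_subset by blast+
  define shift where "shift = (\<lambda>e x. (x + e) mod int p)"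
  have inj: "inj_on (shift e) X" if "X \<subseteq> {0..<int p}" for e X
    using inj_on_subset[OF inj_on_translate_mod that] unfolding shift_def .
  show ?case
  proof (cases "\<exists>x\<in>A. \<exists>b\<in>B. \<not> shift (x - b) ` B \<subseteq> A")
    case True
    then obtain x b where xb: "x \<in> A" "b \<in> B" and not_sub: "\<not> shift (x - b) ` B \<subseteq> A" by blast
    let ?e = "x - b"
    define A' B' where "A' = A \<union> shift ?e ` B" and "B' = {y\<in>B. shift ?e y \<in> A}"
    have "shift ?e b = x" using xb less.prems by (auto simp: shift_def)
    then have "b \<in> B'" using xb by (simp add: B'_def)
    have "B' \<subset> B" using not_sub by (auto simp: B'_def)
    then have "card B' < card B" by (rule psubset_card_mono[OF finB])
    moreover have "A' \<subseteq> {0..<int p}" using less.prems p by (auto simp: A'_def shift_def)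
    ultimately have IH: "min p (card A' + card B' - 1) \<le> card (sumset_mod p A' B')"
      using less.prems \<open>b \<in> B'\<close> \<open>B' \<subset> B\<close> by (intro less.hyps) (auto simp: A'_def)
    have "shift ?e ` B' = A \<inter> shift ?e ` B" by (auto simp: B'_def)
    then have "card B' = card (A \<inter> shift ?e ` B)"
      using card_image[OF inj, of B' ?e] less.prems \<open>B' \<subset> B\<close> by auto
    moreover have "card (shift ?e ` B) = card B" using inj less.prems by (intro card_image) auto
    ultimately have cards: "card A' + card B' = card A + card B"
      using card_Un_Int[of A "shift ?e ` B"] finA finB by (simp add: A'_def)
    have "sumset_mod p A' B' \<subseteq> sumset_mod p A B"
    proof
      fix z assume "z \<in> sumset_mod p A' B'"
      then obtain u v where uv: "u \<in> A'" "v \<in> B'" "z = (u + v) mod int p"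
        by (auto simp: sumset_mod_def)
      show "z \<in> sumset_mod p A B"
      proof (cases "u \<in> A")
        case True
        then show ?thesis using uv sumset_modI[of u A v B p] by (auto simp: B'_def)
      next
        case False
        then obtain w where w: "w \<in> B" "u = shift ?e w" using uv by (auto simp: A'_def)
        \<comment> \<open>The shift by \<open>e\<close> may be moved from the first summand to the second.\<close>
        have "z = (shift ?e v + w) mod int p"
          using uv w by (simp add: shift_def mod_simps algebra_simps)
        then show ?thesis using uv w sumset_modI[of "shift ?e v" A w B p] by (auto simp: B'_def)
      qed
    qed
    then have "card (sumset_mod p A' B') \<le> card (sumset_mod p A B)"
      by (rule card_mono[OF finite_sumset_mod[OF p]])
    then show ?thesis using IH cards by simp
  next
    case False
    then have invariant: "shift (x - b) y \<in> A" if "x \<in> A" "b \<in> B" "y \<in> B" for x b y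
      using that by blast
    obtain b where b: "b \<in> B" using less.prems by blast
    have "card A \<le> card (sumset_mod p A B)"
    proof -
      have "shift b ` A \<subseteq> sumset_mod p A B" using b by (auto simp: shift_def intro: sumset_modI)
      then have "card (shift b ` A) \<le> card (sumset_mod p A B)"
        by (rule card_mono[OF finite_sumset_mod[OF p]])
      then show ?thesis using card_image[OF inj] less.prems by simp
    qed
    moreover have "p \<le> card A" if c: "c \<in> B" "c \<noteq> b" for c
    proof -
      have "\<not> int p dvd c - b"
      proof
        assume "int p dvd c - b"
        then have "c mod int p = b mod int p" by (simp add: mod_eq_dvd_iff)
        moreover have "c mod int p = c" "b mod int p = b" using b c less.prems by auto
        ultimately show False using c by simp
      qed
      moreover have "(x + (c - b)) mod int p \<in> A" if "x \<in> A" for x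
        using invariant[OF that b c(1)] by (simp add: shift_def algebra_simps)
      ultimately have "A = {0..<int p}"
        using less.prems by (intro translation_invariant_imp_full[OF assms(1)]) auto
      then show ?thesis by simp
    qed
    moreover have "card B = 1" if "\<And>c. c \<in> B \<Longrightarrow> c = b"
      using that b by (auto simp: card_1_singleton_iff)
    ultimately show ?thesis
      by (cases "\<exists>c\<in>B. c \<noteq> b") (auto simp: min_def, fastforce+)
  qed
qed

section \<open>Balls of the sine norm\<close>

text \<open>
  The sine measures how far \<open>2 x a\<^sub>i / p\<close> is from an integer. Compared with the distance to the nearest
  integer it has the advantages that the double angle formula and the average over all residues are
  exact, while its absolute value is still subadditive.
\<close>
definition sin_norm :: "nat \<Rightarrow> nat \<Rightarrow> (nat \<Rightarrow> int) \<Rightarrow> int \<Rightarrow> real" where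
  "sin_norm p n a x = L2_set (\<lambda>i. sin (2 * pi * real_of_int (x * a i) / real p)) {1..n}"

lemma sin_norm_0 [simp]: "sin_norm p n a 0 = 0"
  by (simp add: sin_norm_def L2_set_0')

lemma sin_norm_nonneg [simp]: "0 \<le> sin_norm p n a x"
  by (simp add: sin_norm_def)

lemma sin_norm_sq: "sin_norm p n a x ^ 2 = (\<Sum>i\<in>{1..n}. sin (2 * pi * real_of_int (x * a i) / real p) ^ 2)"
  by (simp add: sin_norm_def L2_set_def sum_nonneg)

lemma abs_sin_add_le: "\<bar>sin (x + y)\<bar> \<le> \<bar>sin x\<bar> + \<bar>sin y :: real\<bar>"
proof -
  have "\<bar>sin x * cos y\<bar> \<le> \<bar>sin x\<bar>" "\<bar>cos x * sin y\<bar> \<le> \<bar>sin y\<bar>"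
    unfolding abs_mult by (auto intro: mult_left_le mult_left_le_one_le)
  then show ?thesis unfolding sin_add by linarith
qed

lemma sin_norm_add: "sin_norm p n a (x + y) \<le> sin_norm p n a x + sin_norm p n a y"
proof -
  let ?s = "\<lambda>x i. \<bar>sin (2 * pi * real_of_int (x * a i) / real p)\<bar>"
  have abs: "sin_norm p n a x = L2_set (?s x) {1..n}" for x
    by (simp add: sin_norm_def L2_set_def)
  have "L2_set (?s (x + y)) {1..n} \<le> L2_set (\<lambda>i. ?s x i + ?s y i) {1..n}"
    by (rule L2_set_mono)
       (use abs_sin_add_le in \<open>simp_all add: add_divide_distrib ring_distribs\<close>)
  also have "\<dots> \<le> L2_set (?s x) {1..n} + L2_set (?s y) {1..n}"
    by (rule L2_set_triangle_ineq)
  finally show ?thesis unfolding abs .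
qed

lemma sin_norm_mod:
  assumes "p > 0"
  shows "sin_norm p n a (x mod int p) = sin_norm p n a x"
proof -
  have "sin (2 * pi * real_of_int (x * a i) / real p)
      = sin (2 * pi * real_of_int (x mod int p * a i) / real p)" for i
  proof -
    have "x * a i = x mod int p * a i + int p * (x div int p * a i)"
      by (subst (1) mult_div_mod_eq[symmetric, of x "int p"]) (simp only: algebra_simps)
    then have "2 * pi * real_of_int (x * a i) / real p
        = 2 * pi * real_of_int (x mod int p * a i) / real p + 2 * pi * real_of_int (x div int p * a i)"
      using assms by (simp add: field_simps)
    moreover have "sin (u + 2 * pi * real_of_int m) = sin u" for u m
      by (simp add: sin_add)
    ultimately show ?thesis by (simp only:)
  qed
  then show ?thesis by (simp add: sin_norm_def)
qed

definition sin_ball :: "nat \<Rightarrow> nat \<Rightarrow> (nat \<Rightarrow> int) \<Rightarrow> real \<Rightarrow> int set" where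
  "sin_ball p n a r = {x\<in>{0..<int p}. sin_norm p n a x \<le> r}"

lemma sin_ball_subset: "sin_ball p n a r \<subseteq> {0..<int p}"
  by (auto simp: sin_ball_def)

lemma finite_sin_ball [simp]: "finite (sin_ball p n a r)"
  by (rule finite_subset[OF sin_ball_subset]) simp

lemma zero_in_sin_ball: "p > 0 \<Longrightarrow> r \<ge> 0 \<Longrightarrow> 0 \<in> sin_ball p n a r"
  by (simp add: sin_ball_def)

lemma sin_ball_mono: "r \<le> s \<Longrightarrow> sin_ball p n a r \<subseteq> sin_ball p n a s"
  by (auto simp: sin_ball_def)

lemma sumset_sin_ball:
  assumes "p > 0"
  shows "sumset_mod p (sin_ball p n a r) (sin_ball p n a s) \<subseteq> sin_ball p n a (r + s)"
proof
  fix z assume "z \<in> sumset_mod p (sin_ball p n a r) (sin_ball p n a s)"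
  then obtain x y where xy: "x \<in> sin_ball p n a r" "y \<in> sin_ball p n a s" "z = (x + y) mod int p"
    by (auto simp: sumset_mod_def)
  then have "sin_norm p n a z \<le> r + s"
    using sin_norm_add[of p n a x y] assms by (simp add: sin_ball_def sin_norm_mod)
  then show "z \<in> sin_ball p n a (r + s)" using xy assms by (simp add: sin_ball_def)
qed

text \<open>
  The \<open>m\<close>-fold sumset of a ball of radius \<open>s\<close> lies in the ball of radius \<open>m s\<close>, and it is large by
  iterating the Cauchy-Davenport inequality.
\<close>
lemma card_sin_ball_multiple:
  assumes "prime p" "s \<ge> 0"
  shows "min p (Suc m * (card (sin_ball p n a s) - 1) + 1) \<le> card (sin_ball p n a (real (Suc m) * s))"
proof (induction m)
  case 0
  have "card (sin_ball p n a s) > 0"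
    using zero_in_sin_ball[of p s n a] assms by (auto simp: card_gt_0_iff prime_gt_0_nat)
  then show ?case by simp
next
  case (Suc m)
  have p: "p > 0" using assms(1) by (simp add: prime_gt_0_nat)
  let ?B = "sin_ball p n a"
  have ne: "?B s \<noteq> {}" "?B (real (Suc m) * s) \<noteq> {}"
    using zero_in_sin_ball[OF p] assms(2) by (metis empty_iff mult_nonneg_nonneg of_nat_0_le_iff)+
  have pos: "card (?B s) > 0" using ne by (simp add: card_gt_0_iff)
  have "min p (card (?B (real (Suc m) * s)) + card (?B s) - 1)
      \<le> card (sumset_mod p (?B (real (Suc m) * s)) (?B s))"
    by (rule Cauchy_Davenport[OF assms(1) sin_ball_subset sin_ball_subset ne(2,1)])
  also have "\<dots> \<le> card (?B (real (Suc m) * s + s))"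
    by (rule card_mono[OF finite_sin_ball sumset_sin_ball[OF p]])
  also have "real (Suc m) * s + s = real (Suc (Suc m)) * s"
    by (simp add: algebra_simps)
  finally have step: "min p (card (?B (real (Suc m) * s)) + card (?B s) - 1)
      \<le> card (?B (real (Suc (Suc m)) * s))" .
  have "Suc (Suc m) * (card (?B s) - 1) + 1 = Suc m * (card (?B s) - 1) + 1 + (card (?B s) - 1)"
    by simp
  then show ?case using step Suc.IH pos by linarith
qed

text \<open>
  Apart from the centre, balls grow at least linearly with the radius, as long as they do not fill the
  whole group: take the largest multiple \<open>m s\<close> of \<open>s\<close> not exceeding \<open>r\<close>. Leaving out the centre is what allows the main
  term of the final bound to be \<open>1 / p\<close> with constant one.
\<close>
lemma card_small_sin_ball_le:
  assumes "prime p" "0 < s" "s \<le> r" and proper: "sin_ball p n a r \<noteq> {0..<int p}"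
  shows "real (card (sin_ball p n a s - {0})) \<le> 2 * s / r * real (card (sin_ball p n a r))"
proof -
  have p: "p > 0" using assms(1) by (simp add: prime_gt_0_nat)
  let ?B = "sin_ball p n a"
  define q where "q = r / s"
  have q: "q \<ge> 1" "r = q * s" using assms by (auto simp: q_def)
  \<comment> \<open>The multiple used is \<open>Suc m\<close>, the integer part of \<open>q \<ge> 1\<close>, which is at least \<open>q / 2\<close>.\<close>
  define m where "m = nat \<lfloor>q\<rfloor> - 1"
  have "real (Suc m) \<le> q" "q < real (Suc m) + 1"
    using q(1) unfolding m_def by linarith+
  then have m: "real (Suc m) \<le> q" "q \<le> 2 * real (Suc m)" by simp_all
  have "card (?B r) < card {0..<int p}"
    using proper sin_ball_subset[of p n a r] by (intro psubset_card_mono psubsetI) simp_all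
  moreover have le: "card (?B (real (Suc m) * s)) \<le> card (?B r)"
    using m(1) q assms(2) by (intro card_mono sin_ball_mono) auto
  ultimately have "Suc m * (card (?B s) - 1) + 1 \<le> card (?B r)"
    using card_sin_ball_multiple[OF assms(1), of s m n a] assms(2) by simp
  moreover have "card (?B s - {0}) = card (?B s) - 1"
    using zero_in_sin_ball[OF p] assms(2) by simp
  ultimately have "Suc m * card (?B s - {0}) \<le> card (?B r)" by simp
  then have "real (Suc m) * real (card (?B s - {0})) \<le> real (card (?B r))"
    by (simp only: of_nat_mult[symmetric] of_nat_le_iff)
  moreover have "q * real (card (?B s - {0})) \<le> 2 * real (Suc m) * real (card (?B s - {0}))"
    using m(2) by (intro mult_right_mono) auto
  ultimately have "q * real (card (?B s - {0})) \<le> 2 * real (card (?B r))" by linarith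
  then show ?thesis using assms(2) q by (simp add: field_simps)
qed

section \<open>From cosine products to Gaussian weights\<close>

lemma abs_cos_le_exp_sin: "\<bar>cos u\<bar> \<le> exp (- (sin u ^ 2 / 2 :: real))"
proof (rule power2_le_imp_le)
  have "\<bar>cos u\<bar> ^ 2 = 1 + - (sin u ^ 2)" by (simp add: cos_squared_eq)
  also have "\<dots> \<le> exp (- (sin u ^ 2))" by (rule exp_ge_add_one_self)
  also have "\<dots> = exp (- (sin u ^ 2 / 2)) ^ 2" by (simp flip: exp_double)
  finally show "\<bar>cos u\<bar> ^ 2 \<le> exp (- (sin u ^ 2 / 2)) ^ 2" .
qed simp

lemma rho_le_gaussian_sum:
  assumes "p > 0"
  shows "rho p n a \<le> (\<Sum>x\<in>{0..<int p}. exp (- (sin_norm p n a x ^ 2 / 2))) / real p"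
proof -
  have "(\<Prod>i\<in>{1..n}. \<bar>cos (2 * pi * real_of_int (x * a i) / real p)\<bar>)
      \<le> exp (- (sin_norm p n a x ^ 2 / 2))" for x
  proof -
    have "(\<Prod>i\<in>{1..n}. \<bar>cos (2 * pi * real_of_int (x * a i) / real p)\<bar>)
        \<le> (\<Prod>i\<in>{1..n}. exp (- (sin (2 * pi * real_of_int (x * a i) / real p) ^ 2 / 2)))"
      by (intro prod_mono conjI abs_cos_le_exp_sin) simp
    also have "\<dots> = exp (- (sin_norm p n a x ^ 2 / 2))"
      unfolding sin_norm_sq by (simp only: exp_sum finite_atLeastAtMost sum_negf sum_divide_distrib flip: sum_negf)
    finally show ?thesis .
  qed
  then have "(\<Sum>x\<in>{0..<int p}. \<Prod>i\<in>{1..n}. \<bar>cos (2 * pi * real_of_int (x * a i) / real p)\<bar>)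
      \<le> (\<Sum>x\<in>{0..<int p}. exp (- (sin_norm p n a x ^ 2 / 2)))"
    by (intro sum_mono)
  then show ?thesis
    by (intro order_trans[OF rho_le_cosine_products[OF assms]] divide_right_mono) auto
qed

section \<open>The size of a ball\<close>

lemma sum_cos_double_angle:
  "(\<Sum>i\<in>{1..n}. 2 * cos (2 * pi * real_of_int (2 * x * a i) / real p))
   = 2 * (real n - 2 * sin_norm p n a x ^ 2)"
proof -
  have "cos (2 * pi * real_of_int (2 * x * a i) / real p)
      = 1 - 2 * sin (2 * pi * real_of_int (x * a i) / real p) ^ 2" for i
    using cos_double_sin[of "2 * pi * real_of_int (x * a i) / real p"] by (simp add: mult_ac)
  then show ?thesis
    by (simp add: sin_norm_sq sum_subtractf right_diff_distrib flip: sum_distrib_left)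
qed

text \<open>
  On the ball of radius \<open>r\<close> the cosine sum is at least \<open>2 (n - 2 r\<^sup>2)\<close>, so its \<open>2k\<close>-th power is, by Bernoulli's
  inequality, at least \<open>(2n)\<^sup>2\<^sup>k (1 - 4 k r\<^sup>2 / n) \<ge> 9/10 (2n)\<^sup>2\<^sup>k\<close>. Since even moments are nonnegative, the ball
  cannot be larger than the total \<open>p R\<close> of the moments permits.
\<close>
lemma card_sin_ball_le_R:
  assumes "p > 0" "odd p" "40 * real k * r\<^sup>2 \<le> real n" "n > 0" "r \<ge> 0"
  shows "9 / 10 * (2 * real n) ^ (2 * k) * real (card (sin_ball p n a r)) \<le> real p * real (R p n k a)"
proof -
  let ?moment = "\<lambda>x. (\<Sum>i\<in>{1..n}. 2 * cos (2 * pi * real_of_int (2 * x * a i) / real p)) ^ (2 * k)"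
  have lower: "9 / 10 * (2 * real n) ^ (2 * k) \<le> ?moment x" if "x \<in> sin_ball p n a r" for x
  proof (cases "k = 0")
    case True
    then show ?thesis by simp
  next
    case False
    define y where "y = 2 * sin_norm p n a x ^ 2 / real n"
    have "sin_norm p n a x ^ 2 \<le> r ^ 2"
      using that by (intro power_mono) (auto simp: sin_ball_def)
    then have "40 * real k * sin_norm p n a x ^ 2 \<le> real n"
      using assms(3) by (smt (verit) mult_left_mono of_nat_0_le_iff)
    then have ky: "20 * real k * y \<le> 1" using assms(4) by (simp add: y_def field_simps)
    have "y \<ge> 0" by (simp add: y_def)
    then have "real k * y \<ge> y" using False by (simp add: mult_le_cancel_right1)
    then have "y \<le> 1" using ky \<open>y \<ge> 0\<close> by linarith
    then have "1 + real (2 * k) * (- y) \<le> (1 + - y) ^ (2 * k)"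
      by (intro Bernoulli_inequality) simp
    then have "9 / 10 \<le> (1 - y) ^ (2 * k)" using ky by simp
    then have "9 / 10 * (2 * real n) ^ (2 * k) \<le> (1 - y) ^ (2 * k) * (2 * real n) ^ (2 * k)"
      by (intro mult_right_mono) auto
    also have "\<dots> = ((1 - y) * (2 * real n)) ^ (2 * k)"
      by (rule power_mult_distrib[symmetric])
    also have "(1 - y) * (2 * real n) = 2 * (real n - 2 * sin_norm p n a x ^ 2)"
      using assms(4) by (simp add: y_def field_simps)
    finally show ?thesis unfolding sum_cos_double_angle .
  qed
  have "9 / 10 * (2 * real n) ^ (2 * k) * real (card (sin_ball p n a r))
      \<le> (\<Sum>x\<in>sin_ball p n a r. ?moment x)"
    using sum_bounded_below[of "sin_ball p n a r", OF lower] by (simp add: mult_ac)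
  also have "\<dots> \<le> (\<Sum>x\<in>{0..<int p}. ?moment x)"
    by (rule sum_mono2) (auto simp: sin_ball_def)
  also have "\<dots> = real p * real (R p n k a)"
    by (rule sum_cosine_moments_eq_R[OF assms(1,2)])
  finally show ?thesis .
qed

text \<open>
  For each \<open>i\<close> in the support the average of \<open>sin\<^sup>2 \<theta> = (1 - cos (2\<theta>)) / 2\<close> over all residues is exactly
  \<open>1/2\<close>, because the cosines cancel.
\<close>
lemma sum_sin_norm_sq:
  assumes "p > 0" "odd p" "\<And>i. i \<in> {1..n} \<Longrightarrow> 0 \<le> a i \<and> a i < int p"
  shows "(\<Sum>x\<in>{0..<int p}. sin_norm p n a x ^ 2) = real p * real (card (supp n a)) / 2"
proof -
  have inner: "(\<Sum>x\<in>{0..<int p}. sin (2 * pi * real_of_int (x * a i) / real p) ^ 2)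
      = (if a i = 0 then 0 else real p / 2)" if i: "i \<in> {1..n}" for i
  proof (cases "a i = 0")
    case False
    have "\<not> int p dvd a i" using False assms(3)[OF i] zdvd_not_zless by force
    moreover have "coprime (int p) 2" using assms(2) by simp
    ultimately have "\<not> int p dvd 2 * a i" by (simp add: coprime_dvd_mult_right_iff)
    then have "(\<Sum>x\<in>{0..<int p}. phase p (x * (2 * a i))) = 0"
      by (simp add: sum_phase_residues[OF assms(1)])
    then have "Re (\<Sum>x\<in>{0..<int p}. phase p (x * (2 * a i))) = 0" by simp
    then have "(\<Sum>x\<in>{0..<int p}. cos (2 * pi * real_of_int (x * (2 * a i)) / real p)) = 0"
      by (simp add: phase_def)
    moreover have "sin (2 * pi * real_of_int (x * a i) / real p) ^ 2
        = (1 - cos (2 * pi * real_of_int (x * (2 * a i)) / real p)) / 2" for x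
      using cos_double_sin[of "2 * pi * real_of_int (x * a i) / real p"] by (simp add: mult_ac)
    ultimately show ?thesis
      using False by (simp only: sum_divide_distrib[symmetric] sum_subtractf) simp
  qed simp
  have "(\<Sum>x\<in>{0..<int p}. sin_norm p n a x ^ 2)
      = (\<Sum>i\<in>{1..n}. if a i = 0 then 0 else real p / 2)"
    unfolding sin_norm_sq by (subst sum.swap) (simp only: inner cong: sum.cong)
  also have "\<dots> = (\<Sum>i\<in>supp n a. real p / 2)"
    unfolding supp_def by (rule sum.mono_neutral_cong_right) auto
  finally show ?thesis by (simp add: mult_ac)
qed

text \<open>
  The squared norm cannot be bounded everywhere by less than its average.
\<close>
lemma sin_ball_proper:
  assumes "p > 0" "odd p" "\<And>i. i \<in> {1..n} \<Longrightarrow> 0 \<le> a i \<and> a i < int p"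
    and "r \<ge> 0" "2 * r\<^sup>2 < real (card (supp n a))"
  shows "sin_ball p n a r \<noteq> {0..<int p}"
proof
  assume full: "sin_ball p n a r = {0..<int p}"
  have "sin_norm p n a x ^ 2 \<le> r\<^sup>2" if "x \<in> {0..<int p}" for x
    using that assms(4) unfolding full[symmetric] by (intro power_mono) (auto simp: sin_ball_def)
  then have "(\<Sum>x\<in>{0..<int p}. sin_norm p n a x ^ 2) \<le> (\<Sum>x\<in>{0..<int p}. r\<^sup>2)"
    by (rule sum_mono)
  then have "real p * real (card (supp n a)) / 2 \<le> real p * r\<^sup>2"
    using sum_sin_norm_sq[OF assms(1,2), of n a] assms(3) by simp
  then show False using assms(1,5) by (simp add: field_simps)
qed

section \<open>Summation over layers\<close>

text \<open>
  The term with \<open>i = \<lfloor>u\<rfloor>\<close> alone suffices. This discrete layer-cake bound reduces a sum of \<open>exp (- u x)\<close> over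
  \<open>x\<close> to the sizes of the sublevel sets of \<open>u\<close>.
\<close>
lemma exp_le_sum_layers:
  fixes u :: real
  assumes "0 \<le> u" "u < real N"
  shows "exp (- u) \<le> (\<Sum>i<N. if u \<le> real (Suc i) then (1 / 2) ^ i else 0)"
proof -
  define i where "i = nat \<lfloor>u\<rfloor>"
  have i: "real i \<le> u" "u \<le> real (Suc i)" "i < N"
    using assms unfolding i_def by linarith+
  have "exp (- u) \<le> exp (- real i)" using i by simp
  also have "\<dots> = exp (- 1) ^ i" by (simp flip: exp_of_nat_mult)
  also have "\<dots> \<le> (1 / 2) ^ i"
  proof (rule power_mono)
    have "2 \<le> exp (1 :: real)" using exp_ge_add_one_self[of "1 :: real"] by simp
    then show "exp (- 1 :: real) \<le> 1 / 2" by (simp add: exp_minus field_simps)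
  qed simp
  also have "\<dots> = (if u \<le> real (Suc i) then (1 / 2) ^ i else 0)" using i by simp
  also have "\<dots> \<le> (\<Sum>i<N. if u \<le> real (Suc i) then (1 / 2) ^ i else 0)"
    using i(3) by (intro member_le_sum) auto
  finally show ?thesis .
qed

lemma sum_Suc_half_powers: "(\<Sum>i<N. real (Suc i) * (1 / 2) ^ i) = 4 - (2 * real N + 4) * (1 / 2) ^ N"
proof (induction N)
  case (Suc N)
  show ?case unfolding sum.lessThan_Suc Suc.IH by (simp add: field_simps)
qed simp

text \<open>
  The three terms come from the centre, from the rest of the ball of radius \<open>sqrt (2M)\<close>, and from its
  complement, where each weight is below \<open>exp (- M)\<close>. In the middle part, the layer of weight \<open>2\<^sup>-\<^sup>i\<close> sits in
  the ball of radius \<open>sqrt (2 (i + 1))\<close>, which by linear growth has, without its centre, at most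
  \<open>2 sqrt ((i + 1) / M)\<close> times the size of the large ball; these factors are summable against \<open>2\<^sup>-\<^sup>i\<close>.
\<close>
lemma gaussian_sum_le_card_sin_ball:
  assumes "prime p" "M > 0" and proper: "sin_ball p n a (sqrt (2 * M)) \<noteq> {0..<int p}"
  shows "(\<Sum>x\<in>{0..<int p}. exp (- (sin_norm p n a x ^ 2 / 2)))
     \<le> 1 + 8 * real (card (sin_ball p n a (sqrt (2 * M)))) / sqrt M + real p * exp (- M)"
proof -
  have p: "p > 0" using assms(1) by (simp add: prime_gt_0_nat)
  let ?g = "sin_norm p n a"
  let ?G = "\<lambda>x. exp (- (?g x ^ 2 / 2))"
  define B where "B = sin_ball p n a (sqrt (2 * M))"
  define N where "N = nat \<lceil>M\<rceil> + 1"
  have ball_iff: "?g x \<le> sqrt (2 * c) \<longleftrightarrow> ?g x ^ 2 / 2 \<le> c" for c x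
    using real_sqrt_le_iff[of "?g x ^ 2" "2 * c"] by (simp add: mult.commute)
  have layer: "real (card {x\<in>B - {0}. ?g x ^ 2 / 2 \<le> real (Suc i)})
      \<le> real (Suc i) * (2 * real (card B) / sqrt M)" for i
  proof -
    let ?T = "{x\<in>B - {0}. ?g x ^ 2 / 2 \<le> real (Suc i)}"
    let ?c = "real (card B)"
    have "real (card ?T) \<le> 2 * sqrt (real (Suc i) / M) * ?c"
    proof (cases "real (Suc i) \<le> M")
      case True
      have "?T \<subseteq> sin_ball p n a (sqrt (2 * real (Suc i))) - {0}"
        using ball_iff[of _ "real (Suc i)"] by (auto simp: B_def sin_ball_def)
      then have "real (card ?T) \<le> real (card (sin_ball p n a (sqrt (2 * real (Suc i))) - {0}))"
        by (intro of_nat_mono card_mono) auto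
      also have "\<dots> \<le> 2 * sqrt (2 * real (Suc i)) / sqrt (2 * M) * ?c"
        unfolding B_def using True by (intro card_small_sin_ball_le[OF assms(1) _ _ proper]) auto
      also have "\<dots> = 2 * sqrt (real (Suc i) / M) * ?c"
        by (simp add: real_sqrt_mult real_sqrt_divide del: of_nat_Suc)
      finally show ?thesis .
    next
      case False
      have "card ?T \<le> card B" by (intro card_mono) (auto simp: B_def)
      moreover have "1 \<le> sqrt (real (Suc i) / M)" using False assms(2) by simp
      then have "1 \<le> 2 * sqrt (real (Suc i) / M)" by linarith
      then have "1 * ?c \<le> 2 * sqrt (real (Suc i) / M) * ?c" by (rule mult_right_mono) simp
      ultimately show ?thesis by linarith
    qed
    also have "\<dots> = sqrt (real (Suc i)) * (2 * ?c / sqrt M)"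
      by (simp add: real_sqrt_divide)
    \<comment> \<open>Dropping the root keeps the series over the layers elementary.\<close>
    also have "\<dots> \<le> real (Suc i) * (2 * ?c / sqrt M)"
      using assms(2) by (intro mult_right_mono real_le_lsqrt self_le_power) auto
    finally show ?thesis .
  qed
  have near: "(\<Sum>x\<in>B - {0}. ?G x) \<le> 8 * real (card B) / sqrt M"
  proof -
    have "(\<Sum>x\<in>B - {0}. ?G x)
        \<le> (\<Sum>x\<in>B - {0}. \<Sum>i<N. if ?g x ^ 2 / 2 \<le> real (Suc i) then (1 / 2) ^ i else 0)"
    proof (intro sum_mono exp_le_sum_layers)
      fix x assume "x \<in> B - {0}"
      then have "?g x ^ 2 / 2 \<le> M" using ball_iff[of x M] by (simp add: B_def sin_ball_def)
      also have "M < real N" unfolding N_def by linarith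
      finally show "?g x ^ 2 / 2 < real N" .
    qed simp
    also have "\<dots> = (\<Sum>i<N. (1 / 2) ^ i * real (card {x\<in>B - {0}. ?g x ^ 2 / 2 \<le> real (Suc i)}))"
      by (subst sum.swap) (simp add: sum.If_cases B_def Int_def mult.commute)
    also have "\<dots> \<le> (\<Sum>i<N. (1 / 2) ^ i * (real (Suc i) * (2 * real (card B) / sqrt M)))"
      by (intro sum_mono mult_left_mono layer) simp
    also have "\<dots> = (\<Sum>i<N. real (Suc i) * (1 / 2) ^ i) * (2 * real (card B) / sqrt M)"
      unfolding sum_distrib_right by (intro sum.cong) (simp_all only: mult_ac)
    also have "\<dots> \<le> 4 * (2 * real (card B) / sqrt M)"
      unfolding sum_Suc_half_powers using assms(2) by (intro mult_right_mono) auto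
    finally show ?thesis by simp
  qed
  have far: "(\<Sum>x\<in>{0..<int p} - B. ?G x) \<le> real p * exp (- M)"
  proof -
    have "?G x \<le> exp (- M)" if "x \<in> {0..<int p} - B" for x
      using that ball_iff[of x M] by (auto simp: B_def sin_ball_def)
    then have "(\<Sum>x\<in>{0..<int p} - B. ?G x) \<le> (\<Sum>x\<in>{0..<int p} - B. exp (- M))"
      by (rule sum_mono)
    also have "\<dots> \<le> (\<Sum>x\<in>{0..<int p}. exp (- M))" by (rule sum_mono2) auto
    finally show ?thesis by simp
  qed
  have "0 \<in> B" using zero_in_sin_ball[OF p] assms(2) by (simp add: B_def)
  have "(\<Sum>x\<in>{0..<int p}. ?G x) = (\<Sum>x\<in>{0..<int p} - B. ?G x) + (\<Sum>x\<in>B. ?G x)"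
    unfolding B_def by (intro sum.subset_diff sin_ball_subset) simp
  also have "(\<Sum>x\<in>B. ?G x) = 1 + (\<Sum>x\<in>B - {0}. ?G x)"
    using sum.remove[of B 0 ?G] \<open>0 \<in> B\<close> by (simp add: B_def)
  finally show ?thesis using near far unfolding B_def by linarith
qed

section \<open>The anticoncentration bound\<close>

theorem theorem1p4:
  "\<exists>C :: real. \<forall>(p :: nat) (n :: nat) (a :: nat \<Rightarrow> int) (k :: nat) (M :: real).
     prime p \<longrightarrow> odd p \<longrightarrow> n > 0 \<longrightarrow> a \<in> Fp_vectors p n - {zero_vector n} \<longrightarrow>
     M > 0 \<longrightarrow> 30 * M \<le> real (card (supp n a)) \<longrightarrow> 80 * real k * M \<le> real n \<longrightarrow>
     rho p n a \<le> 1 / real p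
       + C * real (R p n k a) / (2 ^ (2 * k) * real n ^ (2 * k) * sqrt M)
       + exp (- M)"
  \<comment> \<open>The constant is the factor 8 of the layer sum divided by the 9/10 lost in Bernoulli's inequality.\<close>
proof (rule exI[of _ "80 / 9"], intro allI impI)
  fix p n k :: nat and a :: "nat \<Rightarrow> int" and M :: real
  assume pr: "prime p" and odd: "odd p" and n: "n > 0" and a: "a \<in> Fp_vectors p n - {zero_vector n}"
    and M: "M > 0" and supp: "30 * M \<le> real (card (supp n a))" and kM: "80 * real k * M \<le> real n"
  have p: "p > 0" using pr by (simp add: prime_gt_0_nat)
  let ?r = "sqrt (2 * M)"
  define D where "D = (2 * real n) ^ (2 * k)"
  have D: "D > 0" using n by (simp add: D_def)
  have r: "?r \<ge> 0" "?r\<^sup>2 = 2 * M" using M by simp_all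
  have range: "0 \<le> a i \<and> a i < int p" if "i \<in> {1..n}" for i
    using a that by (fastforce simp: Fp_vectors_def residue_ring_def)
  have proper: "sin_ball p n a ?r \<noteq> {0..<int p}"
    using supp M r by (intro sin_ball_proper[OF p odd range]) auto
  have card_ball: "9 / 10 * D * real (card (sin_ball p n a ?r)) \<le> real p * real (R p n k a)"
    unfolding D_def using kM r by (intro card_sin_ball_le_R[OF p odd _ n]) auto
  have "8 * real (card (sin_ball p n a ?r)) / sqrt M
      \<le> real p * (80 / 9 * real (R p n k a) / (D * sqrt M))"
    using card_ball D M by (simp add: field_simps)
  then have "(\<Sum>x\<in>{0..<int p}. exp (- (sin_norm p n a x ^ 2 / 2)))
      \<le> 1 + real p * (80 / 9 * real (R p n k a) / (D * sqrt M)) + real p * exp (- M)"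
    using gaussian_sum_le_card_sin_ball[OF pr M proper] by linarith
  then have "(\<Sum>x\<in>{0..<int p}. exp (- (sin_norm p n a x ^ 2 / 2))) / real p
      \<le> (1 + real p * (80 / 9 * real (R p n k a) / (D * sqrt M)) + real p * exp (- M)) / real p"
    by (rule divide_right_mono) simp
  also have "\<dots> = 1 / real p + 80 / 9 * real (R p n k a) / (D * sqrt M) + exp (- M)"
    using p by (simp add: add_divide_distrib)
  finally show "rho p n a \<le> 1 / real p
       + 80 / 9 * real (R p n k a) / (2 ^ (2 * k) * real n ^ (2 * k) * sqrt M) + exp (- M)"
    using rho_le_gaussian_sum[OF p, of n a] by (simp add: D_def power_mult_distrib)
qed

end
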